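(* Let $p$ be a prime and assume $\aleph_1<2^{\aleph_0}$. Then there is only one locally compact Hausdorff group topology on the group $\sum_{\aleph_1}\mathbb{Z}_p$, namely the discrete one. Under the same assumption $\aleph_1<2^{\aleph_0}$, there exist at least five pairwise nonhomeomorphic locally compact Hausdorff group topologies on the group $\sum_{2^{\aleph_0}}\mathbb{Z}_p$.
   Context: $\mathbb{Z}_p=\mathbb{Z}/p\mathbb{Z}$. For a cardinal $\mathbf{m}$, $\sum_{\mathbf{m}}\mathbb{Z}_p$ denotes the direct sum of $\mathbf{m}$ copies of $\mathbb{Z}_p$, regarded as an abstract Abelian group. *)

theory Defs
  imports
    "HOL-Analysis.Analysis"
    "HOL-Algebra.Product_Groups"
    "HOL-Algebra.Elementary_Groups"
    "HOL-Computational_Algebra.Primes"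
begin

unbundle cardinal_syntax

definition group_topology :: "('a, 'b) monoid_scheme \<Rightarrow> 'a topology \<Rightarrow> bool" where
  "group_topology G T \<longleftrightarrow>
     group G \<and> topspace T = carrier G \<and>
     continuous_map (prod_topology T T) T (\<lambda>(x, y). x \<otimes>\<^bsub>G\<^esub> y) \<and>
     continuous_map T T (\<lambda>x. inv\<^bsub>G\<^esub> x)"

definition lc_hausdorff_group_topology :: "('a, 'b) monoid_scheme \<Rightarrow> 'a topology \<Rightarrow> bool" where
  "lc_hausdorff_group_topology G T \<longleftrightarrow>
     group_topology G T \<and> Hausdorff_space T \<and> locally_compact_space T"

(* Cardinals are cardinal orders on sets: natLeq is aleph_0, so its cardinal successor is aleph_1. *)
abbreviation aleph_one :: "nat set rel" where
  "aleph_one \<equiv> cardSuc natLeq"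

abbreviation continuum :: "(nat \<Rightarrow> bool) rel" where
  "continuum \<equiv> ctwo ^c natLeq"

(* The direct sum of copies of Z/pZ indexed by I: finitely supported elements of the product. *)
abbreviation sum_Zp :: "nat \<Rightarrow> 'i set \<Rightarrow> ('i \<Rightarrow> int) monoid" where
  "sum_Zp p I \<equiv> sum_group I (\<lambda>_. integer_mod_group p)"

end

theory Submission
  imports Defs "HOL-Algebra.Free_Abelian_Groups"
begin

text \<open>
  A nondiscrete topological group has no isolated point, and a nonempty locally compact Hausdorff
  space without isolated points has at least continuum many points; this settles the group of
  cardinality \<open>\<aleph>\<^sub>1\<close>.

  For the second part, Zorn's lemma yields a basis of any elementary abelian \<open>p\<close>-group, so all such
  groups of cardinality continuum are isomorphic to \<open>\<Sum>\<^sub>J \<int>\<^sub>p\<close> and their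
  topologies can be transported to it. Besides the discrete topology, take the product of the compact
  group \<open>\<int>\<^sub>p\<^sup>\<nat>\<close> with the discrete group \<open>\<Sum>\<^sub>L \<int>\<^sub>p\<close>, where \<open>L\<close> is empty or has cardinality
  \<open>\<aleph>\<^sub>0\<close>, \<open>\<aleph>\<^sub>1\<close> or continuum. The size of the discrete factor is a homeomorphism invariant when it
  is infinite, because a compact subset meets only finitely many of the slices.
\<close>

section \<open>Bases of elementary abelian groups\<close>

definition elementary_abelian :: "nat \<Rightarrow> ('a, 'b) monoid_scheme \<Rightarrow> bool" where
  "elementary_abelian p G \<longleftrightarrow> comm_group G \<and> (\<forall>x\<in>carrier G. x [^]\<^bsub>G\<^esub> p = \<one>\<^bsub>G\<^esub>)"

text \<open>In an elementary abelian group of prime exponent the subgroups are exactly the subspaces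
  over the field Z_p, so this is linear independence, phrased through \<open>generate\<close>
  without introducing scalars.\<close>

definition group_independent :: "('a, 'b) monoid_scheme \<Rightarrow> 'a set \<Rightarrow> bool" where
  "group_independent G B \<longleftrightarrow> B \<subseteq> carrier G \<and> (\<forall>b\<in>B. b \<notin> generate G (B - {b}))"

context group
begin

text \<open>An element of a generated subgroup uses only finitely many generators, and finitely many
  members of a chain lie in a single one. The set \<open>D\<close> is carried along because
  independence tests \<open>B - {b}\<close>.\<close>

lemma generate_Union_chain:
  assumes "subset.chain \<A> C" "C \<noteq> {}" "h \<in> generate G (\<Union>C - D)"
  shows "\<exists>X\<in>C. h \<in> generate G (X - D)"
  using assms(3)
proof induction
  case one
  then show ?case using assms(2) generate.one by blast
next
  case (incl h)
  then show ?case by (blast intro: generate.incl)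
next
  case (inv h)
  then show ?case by (blast intro: generate.inv)
next
  case (eng a b)
  then obtain X Y where X: "X \<in> C" "a \<in> generate G (X - D)" and Y: "Y \<in> C" "b \<in> generate G (Y - D)"
    by blast
  have "X \<subseteq> Y \<or> Y \<subseteq> X"
    using assms(1) X(1) Y(1) by (auto simp: subset_chain_def)
  then show ?case
  proof
    assume "X \<subseteq> Y"
    then have "a \<in> generate G (Y - D)"
      using X(2) mono_generate[of "X - D" "Y - D"] by blast
    then show ?thesis using Y generate.eng by metis
  next
    assume "Y \<subseteq> X"
    then have "b \<in> generate G (X - D)"
      using Y(2) mono_generate[of "Y - D" "X - D"] by blast
    then show ?thesis using X generate.eng by metis
  qed
qed

text \<open>Division with remainder: the multiple of \<open>p\<close> in the exponent contributes
  only the neutral element. Residues, the elements of \<open>integer_mod_group p\<close>, can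
  therefore serve as exponents.\<close>

lemma int_pow_mod_exponent:
  assumes "x \<in> carrier G" "x [^] (p::nat) = \<one>"
  shows "x [^] (k mod int p) = x [^] (k::int)"
proof -
  have "x [^] k = x [^] (int p * (k div int p) + k mod int p)"
    by simp
  also have "\<dots> = (x [^] int p) [^] (k div int p) \<otimes> x [^] (k mod int p)"
    using assms(1) by (simp only: int_pow_mult int_pow_pow)
  also have "\<dots> = x [^] (k mod int p)"
    using assms by (simp add: int_pow_int)
  finally show ?thesis by simp
qed

text \<open>By Bezout \<open>k\<close> is invertible modulo \<open>p\<close>, so \<open>x\<close> is
  itself a power of \<open>x [^] k\<close>. This plays the role of division by a nonzero
  scalar.\<close>

lemma mem_subgroup_of_int_pow_mem:
  assumes "subgroup H G" "x \<in> carrier G" "x [^] (p::nat) = \<one>" "x [^] (k::int) \<in> H"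
    and "coprime k (int p)"
  shows "x \<in> H"
proof -
  obtain u v where uv: "u * k + v * int p = 1"
    using bezout_int[of k "int p"] assms(5) by (auto simp: coprime_iff_gcd_eq_1)
  have "(x [^] k) [^] u = x [^] (k * u)"
    using assms(2) by (simp add: int_pow_pow)
  also have "\<dots> = x [^] (k * u mod int p)"
    using int_pow_mod_exponent assms by simp
  also have "k * u mod int p = 1 mod int p"
    by (metis uv mod_mult_self1 mult.commute)
  also have "x [^] (1 mod int p) = x"
    using int_pow_mod_exponent[of x p 1] assms by simp
  finally have "(x [^] k) [^] u = x" .
  moreover have "(x [^] k) [^] u \<in> H"
    using assms by (simp add: subgroup_int_pow_closed)
  ultimately show ?thesis by simp
qed

end

text \<open>Commutativity allows all powers of \<open>x\<close> in a word to be collected into one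
  factor.\<close>

lemma (in comm_group) generate_insert:
  assumes "x \<in> carrier G" "C \<subseteq> carrier G" "h \<in> generate G (insert x C)"
  shows "\<exists>y\<in>generate G C. \<exists>k::int. h = y \<otimes> x [^] k"
  using assms(3)
proof induction
  case one
  show ?case
    by (rule bexI[of _ \<one>], rule exI[of _ 0]) (auto simp: generate.one)
next
  case (incl h)
  show ?case
  proof (cases "h = x")
    case True
    then show ?thesis
      using assms by (intro bexI[of _ \<one>] exI[of _ 1]) (auto simp: generate.one)
  next
    case False
    then show ?thesis
      using assms incl by (intro bexI[of _ h] exI[of _ 0]) (auto intro: generate.incl)
  qed
next
  case (inv h)
  show ?case
  proof (cases "h = x")
    case True
    then show ?thesis
      using assms by (intro bexI[of _ \<one>] exI[of _ "-1"]) (auto simp: generate.one int_pow_neg)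
  next
    case False
    then show ?thesis
      using assms inv by (intro bexI[of _ "inv h"] exI[of _ 0]) (auto intro: generate.inv)
  qed
next
  case (eng a b)
  then obtain y z and k l :: int
    where y: "y \<in> generate G C" "a = y \<otimes> x [^] k" and z: "z \<in> generate G C" "b = z \<otimes> x [^] l"
    by blast
  then have c: "y \<in> carrier G" "z \<in> carrier G"
    using assms(2) generate_in_carrier by auto
  have "a \<otimes> b = (y \<otimes> z) \<otimes> x [^] (k + l)"
    using c assms(1) by (simp add: y z int_pow_mult m_ac)
  then show ?case
    using generate.eng[OF y(1) z(1)] by blast
qed

text \<open>The exchange argument. A dependence of some \<open>b\<close> in \<open>B\<close> on the
  other elements has the form \<open>b = y \<otimes> x [^] k\<close>. If \<open>p\<close> divides
  \<open>k\<close>, then \<open>b\<close> already depends on \<open>B - {b}\<close>; otherwise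
  \<open>k\<close> is invertible modulo \<open>p\<close>, which puts \<open>x\<close> into the span
  of \<open>B\<close>.\<close>

lemma (in comm_group) group_independent_insert:
  assumes p: "prime p" and exp: "\<And>x. x \<in> carrier G \<Longrightarrow> x [^] (p::nat) = \<one>"
    and B: "group_independent G B" and x: "x \<in> carrier G" "x \<notin> generate G B"
  shows "group_independent G (insert x B)"
  unfolding group_independent_def
proof (intro conjI ballI notI)
  show "insert x B \<subseteq> carrier G"
    using B x by (auto simp: group_independent_def)
  have BG: "B \<subseteq> carrier G"
    using B by (auto simp: group_independent_def)
  have xB: "x \<notin> B"
    using x(2) generate.incl by metis
  fix b assume b: "b \<in> insert x B" "b \<in> generate G (insert x B - {b})"
  show False
  proof (cases "b = x")
    case True
    then show ?thesis using b x xB by (simp add: insert_Diff_if)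
  next
    case False
    then have bB: "b \<in> B" using b by auto
    have "insert x B - {b} = insert x (B - {b})" using False by auto
    then obtain y and k :: int where y: "y \<in> generate G (B - {b})" "b = y \<otimes> x [^] k"
      using generate_insert[of x "B - {b}" b] b x BG by auto
    have yB: "y \<in> generate G B"
      using y(1) mono_generate[of "B - {b}" B] by blast
    have yG: "y \<in> carrier G"
      using yB BG generate_in_carrier by blast
    show False
    proof (cases "int p dvd k")
      case True
      then have "x [^] k = \<one>"
        using int_pow_mod_exponent[OF x(1) exp[OF x(1)], of k] by auto
      then show ?thesis
        using y yG B bB by (auto simp: group_independent_def)
    next
      case False
      then have "coprime k (int p)"
        using p by (metis coprime_commute prime_imp_coprime prime_nat_int_transfer)
      moreover have "x [^] k = inv y \<otimes> b"
        using y yG x(1) by (simp add: inv_solve_left)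
      moreover have "inv y \<otimes> b \<in> generate G B"
        using yB bB BG by (intro generate.eng generate_m_inv_closed) (auto intro: generate.incl)
      ultimately show ?thesis
        using mem_subgroup_of_int_pow_mem[OF generate_is_subgroup[OF BG] x(1) exp[OF x(1)]] x(2)
        by metis
    qed
  qed
qed

text \<open>Zorn's lemma gives a maximal independent set; by the exchange argument an element
  outside its span could be added to it.\<close>

lemma (in comm_group) ex_group_independent_generating:
  assumes p: "prime p" and exp: "\<And>x. x \<in> carrier G \<Longrightarrow> x [^] (p::nat) = \<one>"
  shows "\<exists>B. group_independent G B \<and> generate G B = carrier G"
proof -
  have "\<exists>B\<in>Collect (group_independent G). \<forall>X\<in>Collect (group_independent G). B \<subseteq> X \<longrightarrow> X = B"
  proof (rule subset_Zorn_nonempty)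
    show "Collect (group_independent G) \<noteq> {}"
      by (auto simp: group_independent_def intro!: exI[of _ "{}"])
    fix C assume C: "C \<noteq> {}" "subset.chain (Collect (group_independent G)) C"
    then have ind: "\<And>X. X \<in> C \<Longrightarrow> group_independent G X"
      by (auto simp: subset_chain_def)
    have "b \<notin> generate G (\<Union>C - {b})" if b: "b \<in> \<Union>C" for b
    proof
      assume "b \<in> generate G (\<Union>C - {b})"
      \<comment> \<open>The dependence is visible in one member \<open>X\<close> of the chain, which
        need not contain \<open>b\<close>. The larger of \<open>X\<close> and a member containing
        \<open>b\<close> then fails to be independent.\<close>
      then obtain X where X: "X \<in> C" "b \<in> generate G (X - {b})"
        using generate_Union_chain C by metis
      obtain Y where Y: "Y \<in> C" "b \<in> Y" using b by auto
      have "X \<subseteq> Y \<or> Y \<subseteq> X"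
        using C(2) X(1) Y(1) by (auto simp: subset_chain_def)
      then obtain Z where Z: "Z \<in> C" "X \<subseteq> Z" "b \<in> Z"
        using X Y by blast
      then have "b \<in> generate G (Z - {b})"
        using X(2) mono_generate[of "X - {b}" "Z - {b}"] by blast
      then show False
        using ind[OF Z(1)] Z(3) by (auto simp: group_independent_def)
    qed
    then show "\<Union>C \<in> Collect (group_independent G)"
      using ind by (auto simp: group_independent_def)
  qed
  then obtain B where B: "group_independent G B"
    and max: "\<And>X. group_independent G X \<Longrightarrow> B \<subseteq> X \<Longrightarrow> X = B"
    by auto
  have BG: "B \<subseteq> carrier G" using B by (auto simp: group_independent_def)
  have "x \<in> generate G B" if x: "x \<in> carrier G" for x
  proof (rule ccontr)
    assume nx: "x \<notin> generate G B"
    then have "insert x B = B"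
      using group_independent_insert[OF p exp B x] max by blast
    then show False using nx generate.incl by (metis insertI1)
  qed
  then have "generate G B = carrier G"
    using generate_incl[OF BG] by blast
  then show ?thesis using B by blast
qed

text \<open>\<open>gfinprod\<close> is a finite product over the support, and the neutral element if
  the support is infinite; a subgroup contains both.\<close>

lemma (in comm_group) gfinprod_in_subgroup:
  assumes H: "subgroup H G" and f: "f \<in> A \<rightarrow> H"
  shows "gfinprod G f A \<in> H"
proof -
  have HG: "H \<subseteq> carrier G" using H by (rule subgroup.subset)
  have "finprod G f X \<in> H" if "finite X" "X \<subseteq> A" for X
    using that
  proof (induction X rule: finite_induct)
    case empty
    then show ?case using H by (simp add: subgroup.one_closed)
  next
    case (insert a X)
    then have "f \<in> X \<rightarrow> carrier G" "f a \<in> carrier G" "f a \<in> H"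
      using f HG by auto
    then show ?case
      using insert H by (simp add: subgroup.m_closed)
  qed
  then show ?thesis
    using H by (auto simp: gfinprod_def subgroup.one_closed)
qed

section \<open>Direct sums of copies of Z_p: coordinates, cardinality and classification\<close>

lemma carrier_sum_Zp:
  assumes "p > 0"
  shows "carrier (sum_Zp p I) = {x \<in> I \<rightarrow>\<^sub>E {0..<int p}. finite {i \<in> I. x i \<noteq> 0}}"
  using assms by (simp add: carrier_sum_group carrier_integer_mod_group)

lemma finite_carrier_sum_Zp:
  assumes "p > 0" "finite I"
  shows "finite (carrier (sum_Zp p I))"
proof (rule finite_subset)
  show "carrier (sum_Zp p I) \<subseteq> I \<rightarrow>\<^sub>E {0..<int p}"
    using assms(1) by (auto simp: carrier_sum_Zp)
  show "finite (I \<rightarrow>\<^sub>E {0..<int p})"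
    using assms(2) by (intro finite_PiE) auto
qed

text \<open>A family of exponents is sent to the product of the corresponding powers of basis
  elements. Generation makes this map surjective and independence makes its kernel trivial. The
  bijection \<open>g\<close> permits an index set of a type other than that of the group.\<close>

lemma iso_sum_Zp_of_basis:
  assumes p: "prime p" and G: "elementary_abelian p G"
    and B: "group_independent G B" "generate G B = carrier G" and g: "bij_betw g J B"
  shows "(\<lambda>x. gfinprod G (\<lambda>j. g j [^]\<^bsub>G\<^esub> x j) J) \<in> iso (sum_Zp p J) G"
proof -
  interpret comm_group G using G by (simp add: elementary_abelian_def)
  have exp: "x [^]\<^bsub>G\<^esub> p = \<one>\<^bsub>G\<^esub>" if "x \<in> carrier G" for x
    using G that by (simp add: elementary_abelian_def)
  define \<phi> where "\<phi> = (\<lambda>x. gfinprod G (\<lambda>j. g j [^]\<^bsub>G\<^esub> (x j :: int)) J)"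
  have BG: "B \<subseteq> carrier G" using B by (simp add: group_independent_def)
  have gB: "g j \<in> B" if "j \<in> J" for j using g that by (auto simp: bij_betw_def)
  have gG: "g j \<in> carrier G" if "j \<in> J" for j using gB[OF that] BG by auto
  have p0: "p > 1" using p by (rule prime_gt_1_nat)
  \<comment> \<open>The homomorphisms on the single summands combine to one on the direct
    sum.\<close>
  have "(\<lambda>k::int. g j [^]\<^bsub>G\<^esub> k) \<in> hom (integer_mod_group p) G" if "j \<in> J" for j
    using gG[OF that] by (auto simp: hom_def int_pow_mod_exponent[OF gG[OF that] exp] int_pow_mult)
  then have hom: "\<phi> \<in> hom (sum_Zp p J) G"
    unfolding \<phi>_def by (intro hom_group_sum) auto
  interpret h: group_hom "sum_Zp p J" G \<phi>
    using hom by (simp add: group_hom_def group_hom_axioms_def is_group)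
  have carr: "carrier (sum_Zp p J) = {x \<in> J \<rightarrow>\<^sub>E {0..<int p}. finite {i \<in> J. x i \<noteq> 0}}"
    using p0 by (simp add: carrier_sum_Zp)
  have "B \<subseteq> \<phi> ` carrier (sum_Zp p J)"
  proof
    fix b assume "b \<in> B"
    then obtain j where j: "j \<in> J" "b = g j" using g by (auto simp: bij_betw_def)
    \<comment> \<open>The unit vector at \<open>j\<close> is mapped to the basis element
      \<open>b\<close>.\<close>
    define e where "e = (\<lambda>i\<in>J. if i = j then 1 else 0 :: int)"
    have e: "e \<in> carrier (sum_Zp p J)"
      unfolding carr e_def using p0 by (auto intro: finite_subset[of _ "{j}"])
    have "\<phi> e = gfinprod G (\<lambda>i. g i [^]\<^bsub>G\<^esub> e i) {j}"
      unfolding \<phi>_def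
      by (rule gfinprod_mono_neutral_cong_right) (use j gG in \<open>auto simp: e_def\<close>)
    also have "\<dots> = b"
      using j gG by (simp add: e_def)
    finally show "b \<in> \<phi> ` carrier (sum_Zp p J)" using e by blast
  qed
  then have surj: "carrier G \<subseteq> \<phi> ` carrier (sum_Zp p J)"
    using generate_subgroup_incl[OF _ h.img_is_subgroup] B by metis
  have inj: "x = \<one>\<^bsub>sum_Zp p J\<^esub>" if x: "x \<in> carrier (sum_Zp p J)" and eq: "\<phi> x = \<one>\<^bsub>G\<^esub>" for x
  proof (rule ccontr)
    assume ne: "x \<noteq> \<one>\<^bsub>sum_Zp p J\<^esub>"
    have xE: "x \<in> J \<rightarrow>\<^sub>E {0..<int p}" and fin: "finite {i \<in> J. x i \<noteq> 0}"
      using x by (auto simp: carr)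
    have "\<exists>j\<in>J. x j \<noteq> 0"
      using ne xE by (fastforce simp: fun_eq_iff PiE_iff extensional_def split: if_splits)
    \<comment> \<open>Splitting off a nonzero coordinate \<open>j\<close> shows that
      \<open>g j\<close> to the power \<open>x j\<close> lies in the span of the other basis
      elements. Since \<open>0 < x j < p\<close>, the exponent is invertible modulo
      \<open>p\<close>, so \<open>g j\<close> lies there too, against independence.\<close>
    then obtain j where j: "j \<in> J" "x j \<noteq> 0" by blast
    let ?f = "\<lambda>i. g i [^]\<^bsub>G\<^esub> x i" and ?H = "generate G (B - {g j})"
    have sub: "subgroup ?H G" using BG by (intro generate_is_subgroup) auto
    have "g i \<in> ?H" if "i \<in> J - {j}" for i
      using that j g by (intro generate.incl) (auto simp: bij_betw_def inj_on_def)
    then have rest: "gfinprod G ?f (J - {j}) \<in> ?H"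
      by (intro gfinprod_in_subgroup[OF sub]) (auto intro: subgroup_int_pow_closed[OF sub])
    have finJ: "finite {i \<in> J - {j}. ?f i \<noteq> \<one>\<^bsub>G\<^esub>}"
      by (rule finite_subset[OF _ fin]) auto
    have "\<phi> x = gfinprod G ?f (insert j (J - {j}))"
      using j by (simp add: \<phi>_def insert_absorb)
    also have "\<dots> = ?f j \<otimes>\<^bsub>G\<^esub> gfinprod G ?f (J - {j})"
      using finJ gG j by (subst gfinprod_insert) auto
    finally have "?f j \<otimes>\<^bsub>G\<^esub> gfinprod G ?f (J - {j}) = \<one>\<^bsub>G\<^esub>" using eq by simp
    then have "?f j = inv\<^bsub>G\<^esub> (gfinprod G ?f (J - {j}))"
      using rest subgroup.subset[OF sub] j gG by (intro inv_equality[symmetric]) auto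
    then have "?f j \<in> ?H"
      using rest subgroup.m_inv_closed[OF sub] by simp
    moreover have "coprime (x j) (int p)"
    proof -
      have "0 < x j" "x j < int p" using xE j by (force simp: PiE_iff)+
      then have "\<not> int p dvd x j" by (simp add: zdvd_not_zless)
      then show ?thesis
        using p by (metis coprime_commute prime_imp_coprime prime_nat_int_transfer)
    qed
    ultimately have "g j \<in> ?H"
      using mem_subgroup_of_int_pow_mem[OF sub gG[OF j(1)] exp[OF gG[OF j(1)]]] by blast
    then show False
      using B gB[OF j(1)] by (simp add: group_independent_def)
  qed
  show ?thesis
    using surj inj by (simp add: h.iso_iff flip: \<phi>_def)
qed

text \<open>Elements inject into the finite subsets of \<open>I \<times> UNIV\<close>, and an
  infinite set has as many finite subsets as elements. Unit vectors give the reverse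
  inequality.\<close>

lemma card_of_sum_Zp:
  fixes I :: "'i set"
  assumes "infinite I" "prime p"
  shows "|carrier (sum_Zp p I)| =o |I|"
proof -
  have p1: "p > 1" using assms(2) by (rule prime_gt_1_nat)
  have carr: "carrier (sum_Zp p I) = {x \<in> I \<rightarrow>\<^sub>E {0..<int p}. finite {i \<in> I. x i \<noteq> 0}}"
    using p1 by (simp add: carrier_sum_Zp)
  have infP: "infinite (I \<times> (UNIV::int set))"
    using assms(1) by (auto simp: finite_cartesian_product_iff)
  have "|UNIV::int set| \<le>o |UNIV::nat set|"
    by (meson card_of_ordLeq countable_def top_greatest uncountable_def countableI_type)
  also have "|UNIV::nat set| \<le>o |I|"
    using assms(1) infinite_iff_card_of_nat by blast
  finally have int: "|UNIV::int set| \<le>o |I|" .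
  \<comment> \<open>A finitely supported function is determined by its graph over the support.\<close>
  let ?s = "\<lambda>x::'i \<Rightarrow> int. (\<lambda>i. (i, x i)) ` {i \<in> I. x i \<noteq> 0}"
  have "inj_on ?s (carrier (sum_Zp p I))"
  proof (rule inj_onI)
    fix x y assume x: "x \<in> carrier (sum_Zp p I)" and y: "y \<in> carrier (sum_Zp p I)" and eq: "?s x = ?s y"
    show "x = y"
    proof
      fix i
      have *: "(i, k) \<in> ?s x \<longleftrightarrow> (i, k) \<in> ?s y" for k using eq by simp
      show "x i = y i"
      proof (cases "i \<in> I")
        case True
        then show ?thesis using *[of "x i"] *[of "y i"] by (auto simp: image_iff)
      qed (use x y in \<open>auto simp: carr PiE_iff extensional_def\<close>)
    qed
  qed
  moreover have "?s ` carrier (sum_Zp p I) \<subseteq> Fpow (I \<times> UNIV)"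
    by (auto simp: carr Fpow_def)
  ultimately have "|carrier (sum_Zp p I)| \<le>o |Fpow (I \<times> (UNIV::int set))|"
    using card_of_ordLeq by blast
  also have "|Fpow (I \<times> (UNIV::int set))| =o |I \<times> (UNIV::int set)|"
    using eqpoll_Fpow[OF infP] by (simp add: eqpoll_iff_card_of_ordIso)
  also have "|I \<times> (UNIV::int set)| =o |I|"
    using card_of_Times_infinite[OF assms(1) UNIV_not_empty int] by simp
  finally have le: "|carrier (sum_Zp p I)| \<le>o |I|" .
  let ?e = "\<lambda>j. \<lambda>i\<in>I. if i = j then 1 else 0 :: int"
  have "inj_on ?e I"
    by (rule inj_onI) (auto simp: fun_eq_iff split: if_splits)
  moreover have "?e ` I \<subseteq> carrier (sum_Zp p I)"
    using p1 by (auto simp: carr intro: finite_subset[of _ "{_}"])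
  ultimately have "|I| \<le>o |carrier (sum_Zp p I)|"
    using card_of_ordLeq by blast
  with le show ?thesis by (simp add: ordIso_iff_ordLeq)
qed

text \<open>A basis of an infinite elementary abelian \<open>p\<close>-group is infinite, hence has
  the cardinality of the group. Cardinality thus determines the group up to isomorphism.\<close>

lemma is_iso_sum_Zp:
  assumes "prime p" "elementary_abelian p G" "infinite J" "|carrier G| =o |J|"
  shows "sum_Zp p J \<cong> G"
proof -
  interpret comm_group G using assms(2) by (simp add: elementary_abelian_def)
  obtain B where B: "group_independent G B" "generate G B = carrier G"
    using ex_group_independent_generating[OF assms(1)] assms(2) by (auto simp: elementary_abelian_def)
  have iso: "|carrier (sum_Zp p B)| =o |carrier G|"
    using iso_sum_Zp_of_basis[OF assms(1,2) B bij_betw_id] card_of_ordIso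
    by (fastforce simp: iso_def)
  have "infinite B"
  proof
    assume "finite B"
    then have "finite (carrier (sum_Zp p B))"
      using finite_carrier_sum_Zp prime_gt_0_nat[OF assms(1)] by blast
    then show False
      using card_of_ordIso_finite[OF iso] card_of_ordIso_finite[OF assms(4)] assms(3) by blast
  qed
  then have "|J| =o |B|"
    by (meson assms card_of_sum_Zp iso ordIso_symmetric ordIso_transitive)
  then obtain g where "bij_betw g J B" using card_of_ordIso by blast
  then show ?thesis
    using iso_sum_Zp_of_basis[OF assms(1,2) B] by (auto simp: is_iso_def)
qed

section \<open>Locally compact group topologies\<close>

lemma continuum_eq: "continuum = |UNIV :: (nat \<Rightarrow> bool) set|"
  by (simp add: cexp_def ctwo_def Field_natLeq Field_card_of Func_def)

text \<open>The lower bound for the size of perfect locally compact Hausdorff spaces is phrased with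
  the reals; this links it to the cardinal power.\<close>

lemma continuum_ordIso_real: "continuum =o |UNIV :: real set|"
proof -
  have "bij (Collect :: (nat \<Rightarrow> bool) \<Rightarrow> nat set)"
    by (rule bij_betw_byWitness[of _ "\<lambda>A x. x \<in> A"]) auto
  then have "|UNIV :: (nat \<Rightarrow> bool) set| =o |UNIV :: nat set set|"
    using card_of_ordIso by blast
  also have "|UNIV :: nat set set| =o |UNIV :: real set|"
    using nat_sets_eqpoll_reals by (simp add: eqpoll_iff_card_of_ordIso)
  finally show ?thesis by (simp add: continuum_eq)
qed

lemma group_topology_openin_translate:
  assumes T: "group_topology G T" and U: "openin T U" and g: "g \<in> carrier G"
  shows "openin T {x \<in> carrier G. g \<otimes>\<^bsub>G\<^esub> x \<in> U}"
proof -
  have mult: "continuous_map (prod_topology T T) T (\<lambda>(x, y). x \<otimes>\<^bsub>G\<^esub> y)" and sp: "topspace T = carrier G"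
    using T by (auto simp: group_topology_def)
  have "continuous_map T (prod_topology T T) (\<lambda>x. (g, x))"
    using g sp by (simp add: continuous_map_pairedI)
  then have "continuous_map T T (\<lambda>x. g \<otimes>\<^bsub>G\<^esub> x)"
    using continuous_map_compose[OF _ mult] by (fastforce simp: o_def)
  from openin_continuous_map_preimage[OF this U] show ?thesis
    by (simp add: sp)
qed

text \<open>By homogeneity one isolated point makes every point isolated. In the nondiscrete case
  the space is therefore perfect, and the reals inject into it.\<close>

lemma lc_hausdorff_group_topology_small_imp_discrete:
  assumes T: "lc_hausdorff_group_topology G T" and small: "|carrier G| <o continuum"
  shows "T = discrete_topology (carrier G)"
proof (rule ccontr)
  assume nd: "T \<noteq> discrete_topology (carrier G)"
  have gt: "group_topology G T" and haus: "Hausdorff_space T" and lc: "locally_compact_space T"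
    using T by (auto simp: lc_hausdorff_group_topology_def)
  interpret group G using gt by (simp add: group_topology_def)
  have sp: "topspace T = carrier G" using gt by (simp add: group_topology_def)
  have "\<not> openin T {a}" if a: "a \<in> carrier G" for a
  proof
    assume op: "openin T {a}"
    have "openin T {x}" if x: "x \<in> carrier G" for x
    proof -
      \<comment> \<open>Translation by \<open>a\<close> times the inverse of \<open>x\<close> takes
        only \<open>x\<close> to \<open>a\<close>, so the open set \<open>{a}\<close> has preimage
        \<open>{x}\<close>.\<close>
      have "{y \<in> carrier G. (a \<otimes>\<^bsub>G\<^esub> inv\<^bsub>G\<^esub> x) \<otimes>\<^bsub>G\<^esub> y \<in> {a}} = {x}"
        using a x by (auto simp: m_assoc) (metis inv_closed inv_equality inv_inv)
      then show ?thesis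
        using group_topology_openin_translate[OF gt op, of "a \<otimes>\<^bsub>G\<^esub> inv\<^bsub>G\<^esub> x"] a x by simp
    qed
    then show False
      using nd sp discrete_topology_unique by metis
  qed
  then have "T derived_set_of topspace T = topspace T"
    using derived_set_of_topspace[of T] by (auto simp: sp)
  moreover have "topspace T \<noteq> {}" using sp by auto
  ultimately have "(UNIV :: real set) \<lesssim> topspace T"
    using lepoll_perfect_set lc haus by blast
  then have "|UNIV :: real set| \<le>o |carrier G|"
    by (simp add: lepoll_def sp card_of_ordLeq)
  then have "continuum \<le>o |carrier G|"
    using continuum_ordIso_real ordIso_ordLeq_trans by blast
  then show False
    using small not_ordLess_ordLeq by blast
qed

lemma lc_hausdorff_group_topology_discrete:
  assumes "group G"
  shows "lc_hausdorff_group_topology G (discrete_topology (carrier G))"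
proof -
  interpret group G by fact
  show ?thesis
    by (auto simp: lc_hausdorff_group_topology_def group_topology_def assms
        locally_compact_space_discrete_topology simp flip: prod_topology_discrete_topology)
qed

section \<open>Transport and products of group topologies\<close>

lemma lc_hausdorff_group_topology_pullback:
  assumes T: "lc_hausdorff_group_topology G T" and H: "group H" and \<phi>: "\<phi> \<in> iso H G"
  shows "lc_hausdorff_group_topology H (pullback_topology (carrier H) \<phi> T)"
    and "pullback_topology (carrier H) \<phi> T homeomorphic_space T"
proof -
  let ?P = "pullback_topology (carrier H) \<phi> T"
  have sp: "topspace T = carrier G" and G: "group G"
    and mult: "continuous_map (prod_topology T T) T (\<lambda>(x, y). x \<otimes>\<^bsub>G\<^esub> y)"
    and inver: "continuous_map T T (\<lambda>x. inv\<^bsub>G\<^esub> x)"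
    using T by (auto simp: lc_hausdorff_group_topology_def group_topology_def)
  have bij: "bij_betw \<phi> (carrier H) (carrier G)" and hom: "\<phi> \<in> hom H G"
    using \<phi> by (auto simp: iso_def)
  interpret group_hom H G \<phi>
    using G H hom by (simp add: group_hom_def group_hom_axioms_def)
  have spP: "topspace ?P = carrier H"
    by (auto simp: topspace_pullback_topology sp)
  have c\<phi>: "continuous_map ?P T \<phi>"
    using continuous_map_pullback[OF continuous_map_id] by simp
  have "homeomorphic_maps ?P T \<phi> (inv_into (carrier H) \<phi>)"
    unfolding homeomorphic_maps_def
  proof (intro conjI ballI)
    show "continuous_map T ?P (inv_into (carrier H) \<phi>)"
    proof (rule continuous_map_pullback')
      show "continuous_map T T (\<phi> \<circ> inv_into (carrier H) \<phi>)"
        by (rule continuous_map_eq[OF continuous_map_id])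
          (use bij sp in \<open>auto simp: bij_betw_inv_into_right\<close>)
      show "topspace T \<subseteq> inv_into (carrier H) \<phi> -` carrier H"
        using bij_betw_inv_into[OF bij] sp by (auto simp: bij_betw_def)
    qed
  qed (use bij c\<phi> in \<open>auto simp: spP sp bij_betw_inv_into_left bij_betw_inv_into_right\<close>)
  then show homeo: "?P homeomorphic_space T"
    unfolding homeomorphic_space_def by blast
  \<comment> \<open>Continuity into a pullback topology is tested after composing with
    \<open>\<phi>\<close>, and the homomorphism property turns the operations of \<open>H\<close>
    into those of \<open>G\<close>.\<close>
  have "continuous_map (prod_topology ?P ?P) T ((\<lambda>(x, y). x \<otimes>\<^bsub>G\<^esub> y) \<circ> (\<lambda>(x, y). (\<phi> x, \<phi> y)))"
    by (intro continuous_map_compose[OF _ mult]) (simp add: continuous_map_prod_top c\<phi>)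
  then have "continuous_map (prod_topology ?P ?P) T (\<phi> \<circ> (\<lambda>(x, y). x \<otimes>\<^bsub>H\<^esub> y))"
    by (rule continuous_map_eq) (auto simp: spP)
  then have m: "continuous_map (prod_topology ?P ?P) ?P (\<lambda>(x, y). x \<otimes>\<^bsub>H\<^esub> y)"
    by (rule continuous_map_pullback') (auto simp: spP)
  have "continuous_map ?P T ((\<lambda>x. inv\<^bsub>G\<^esub> x) \<circ> \<phi>)"
    by (rule continuous_map_compose[OF c\<phi> inver])
  then have "continuous_map ?P T (\<phi> \<circ> (\<lambda>x. inv\<^bsub>H\<^esub> x))"
    by (rule continuous_map_eq) (auto simp: spP)
  then have i: "continuous_map ?P ?P (\<lambda>x. inv\<^bsub>H\<^esub> x)"
    by (rule continuous_map_pullback') (auto simp: spP)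
  have "Hausdorff_space ?P" "locally_compact_space ?P"
    using T homeomorphic_Hausdorff_space[OF homeo] homeomorphic_locally_compact_space[OF homeo]
    by (auto simp: lc_hausdorff_group_topology_def)
  then show "lc_hausdorff_group_topology H ?P"
    using m i H spP by (simp add: lc_hausdorff_group_topology_def group_topology_def)
qed

lemma lc_hausdorff_group_topology_DirProd:
  assumes S: "lc_hausdorff_group_topology G S" and T: "lc_hausdorff_group_topology H T"
  shows "lc_hausdorff_group_topology (G \<times>\<times> H) (prod_topology S T)"
proof -
  have G: "group G" "topspace S = carrier G"
    "continuous_map (prod_topology S S) S (\<lambda>(x, y). x \<otimes>\<^bsub>G\<^esub> y)"
    "continuous_map S S (\<lambda>x. inv\<^bsub>G\<^esub> x)"
    using S by (auto simp: lc_hausdorff_group_topology_def group_topology_def)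
  have H: "group H" "topspace T = carrier H"
    "continuous_map (prod_topology T T) T (\<lambda>(x, y). x \<otimes>\<^bsub>H\<^esub> y)"
    "continuous_map T T (\<lambda>x. inv\<^bsub>H\<^esub> x)"
    using T by (auto simp: lc_hausdorff_group_topology_def group_topology_def)
  let ?P = "prod_topology S T"
  let ?Q = "prod_topology ?P ?P"
  have f: "continuous_map ?Q S (\<lambda>z. fst (fst z))" "continuous_map ?Q S (\<lambda>z. fst (snd z))"
    "continuous_map ?Q T (\<lambda>z. snd (fst z))" "continuous_map ?Q T (\<lambda>z. snd (snd z))"
    using continuous_map_compose[OF continuous_map_fst continuous_map_fst]
      continuous_map_compose[OF continuous_map_snd continuous_map_fst]
      continuous_map_compose[OF continuous_map_fst continuous_map_snd]
      continuous_map_compose[OF continuous_map_snd continuous_map_snd]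
    by (simp_all add: o_def)
  have "continuous_map ?Q S (\<lambda>z. fst (fst z) \<otimes>\<^bsub>G\<^esub> fst (snd z))"
    using continuous_map_compose[OF continuous_map_pairedI[OF f(1,2)] G(3)] by (simp add: o_def)
  moreover have "continuous_map ?Q T (\<lambda>z. snd (fst z) \<otimes>\<^bsub>H\<^esub> snd (snd z))"
    using continuous_map_compose[OF continuous_map_pairedI[OF f(3,4)] H(3)] by (simp add: o_def)
  ultimately have m: "continuous_map ?Q ?P (\<lambda>(x, y). x \<otimes>\<^bsub>G \<times>\<times> H\<^esub> y)"
    by (simp add: mult_DirProd' case_prod_unfold continuous_map_pairedI)
  have "continuous_map ?P ?P (\<lambda>(x, y). (inv\<^bsub>G\<^esub> x, inv\<^bsub>H\<^esub> y))"
    using G(4) H(4) by (simp add: continuous_map_prod_top)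
  then have i: "continuous_map ?P ?P (\<lambda>x. inv\<^bsub>G \<times>\<times> H\<^esub> x)"
    by (rule continuous_map_eq) (auto simp: G H)
  show ?thesis
    using m i S T G(1,2) H(1,2)
    by (auto simp: lc_hausdorff_group_topology_def group_topology_def DirProd_group
        Hausdorff_space_prod_topology locally_compact_space_prod_topology)
qed

text \<open>An infinite product of locally compact spaces can fail to be locally compact. Compact
  factors avoid this: by Tychonoff's theorem the product is compact.\<close>

lemma lc_hausdorff_group_topology_product_group:
  assumes T: "\<And>i. i \<in> I \<Longrightarrow> lc_hausdorff_group_topology (G i) (T i)"
    and cpt: "\<And>i. i \<in> I \<Longrightarrow> compact_space (T i)"
  shows "lc_hausdorff_group_topology (product_group I G) (product_topology T I)"
proof -
  have G: "group (G i)" "topspace (T i) = carrier (G i)" "Hausdorff_space (T i)"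
    "continuous_map (prod_topology (T i) (T i)) (T i) (\<lambda>(x, y). x \<otimes>\<^bsub>G i\<^esub> y)"
    "continuous_map (T i) (T i) (\<lambda>x. inv\<^bsub>G i\<^esub> x)" if "i \<in> I" for i
    using T[OF that] by (auto simp: lc_hausdorff_group_topology_def group_topology_def)
  let ?P = "product_topology T I"
  let ?Q = "prod_topology ?P ?P"
  have sp: "topspace ?P = carrier (product_group I G)"
    using G(2) by (simp cong: PiE_cong)
  have proj: "continuous_map ?Q (T i) (\<lambda>z. fst z i)" "continuous_map ?Q (T i) (\<lambda>z. snd z i)" if "i \<in> I" for i
    using continuous_map_compose[OF continuous_map_fst continuous_map_product_projection[OF that]]
      continuous_map_compose[OF continuous_map_snd continuous_map_product_projection[OF that]]
    by (simp_all add: o_def)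
  have "continuous_map ?Q (T i) (\<lambda>z. fst z i \<otimes>\<^bsub>G i\<^esub> snd z i)" if "i \<in> I" for i
    using continuous_map_compose[OF continuous_map_pairedI[OF proj[OF that]] G(4)[OF that]]
    by (simp add: o_def)
  then have m: "continuous_map ?Q ?P (\<lambda>(x, y). x \<otimes>\<^bsub>product_group I G\<^esub> y)"
    by (auto simp: continuous_map_componentwise case_prod_unfold)
  have "continuous_map ?P (T i) (\<lambda>x. inv\<^bsub>G i\<^esub> (x i))" if "i \<in> I" for i
    using continuous_map_compose[OF continuous_map_product_projection[OF that, of T] G(5)[OF that]]
    by (simp add: o_def)
  then have "continuous_map ?P ?P (\<lambda>x. \<lambda>i\<in>I. inv\<^bsub>G i\<^esub> (x i))"
    by (auto simp: continuous_map_componentwise)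
  then have i: "continuous_map ?P ?P (\<lambda>x. inv\<^bsub>product_group I G\<^esub> x)"
    by (rule continuous_map_eq) (use sp G in auto)
  have "compact_space ?P"
    using cpt by (simp add: compact_space_product_topology)
  then show ?thesis
    using m i sp G
    by (auto simp: lc_hausdorff_group_topology_def group_topology_def Hausdorff_space_product_topology
        compact_imp_locally_compact_space)
qed

section \<open>Compact times discrete\<close>

lemma elementary_abelian_product_group:
  assumes "\<And>i. i \<in> I \<Longrightarrow> elementary_abelian p (G i)"
  shows "elementary_abelian p (product_group I G)"
proof -
  have cg: "comm_group (G i)" and exp: "\<And>x. x \<in> carrier (G i) \<Longrightarrow> x [^]\<^bsub>G i\<^esub> p = \<one>\<^bsub>G i\<^esub>" if "i \<in> I" for i
    using assms[OF that] by (auto simp: elementary_abelian_def)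
  then have grp: "group (product_group I G)"
    by (simp add: comm_group.axioms)
  have pow: "x [^]\<^bsub>product_group I G\<^esub> (n::nat) = (\<lambda>i\<in>I. x i [^]\<^bsub>G i\<^esub> n)" for x n
    by (induction n) (auto simp: fun_eq_iff)
  show ?thesis
    unfolding elementary_abelian_def
  proof (intro conjI ballI)
    show "comm_group (product_group I G)"
    proof (rule group.group_comm_groupI[OF grp])
      fix x y assume "x \<in> carrier (product_group I G)" "y \<in> carrier (product_group I G)"
      then show "x \<otimes>\<^bsub>product_group I G\<^esub> y = y \<otimes>\<^bsub>product_group I G\<^esub> x"
        using cg by (auto simp: PiE_iff intro!: restrict_ext comm_monoid.m_comm comm_group.axioms)
    qed
    fix x assume "x \<in> carrier (product_group I G)"
    then show "x [^]\<^bsub>product_group I G\<^esub> p = \<one>\<^bsub>product_group I G\<^esub>"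
      using exp by (auto simp: pow PiE_iff intro!: restrict_ext)
  qed
qed

lemma elementary_abelian_subgroup_generated:
  assumes "elementary_abelian p G"
  shows "elementary_abelian p (subgroup_generated G S)"
proof -
  interpret comm_group G using assms by (simp add: elementary_abelian_def)
  show ?thesis
    using assms carrier_subgroup_generated_subset abelian_subgroup_generated[OF comm_group_axioms]
    by (auto simp: elementary_abelian_def pow_subgroup_generated)
qed

lemma elementary_abelian_DirProd:
  assumes G: "elementary_abelian p G" and H: "elementary_abelian p H"
  shows "elementary_abelian p (G \<times>\<times> H)"
proof -
  interpret G: comm_group G using G by (simp add: elementary_abelian_def)
  interpret H: comm_group H using H by (simp add: elementary_abelian_def)
  have "(x, y) [^]\<^bsub>G \<times>\<times> H\<^esub> (n::nat) = (x [^]\<^bsub>G\<^esub> n, y [^]\<^bsub>H\<^esub> n)" for x y n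
    by (induction n) auto
  moreover have "comm_group (G \<times>\<times> H)"
    by (rule group.group_comm_groupI[OF DirProd_group[OF G.is_group H.is_group]])
      (auto simp: G.m_comm H.m_comm)
  ultimately show ?thesis
    using G H by (auto simp: elementary_abelian_def)
qed

lemma elementary_abelian_integer_mod_group: "elementary_abelian p (integer_mod_group p)"
  by (simp add: elementary_abelian_def)

text \<open>\<open>sum_group\<close> is defined as a generated subgroup of the full product and
  inherits the property from it.\<close>

lemma elementary_abelian_sum_Zp: "elementary_abelian p (sum_Zp p L)"
  unfolding sum_group_def
  by (intro elementary_abelian_subgroup_generated elementary_abelian_product_group
      elementary_abelian_integer_mod_group)

text \<open>A sequence is coded by the characteristic function of its graph, with pairs numbered by
  \<open>prod_decode\<close>. Conversely, 0-1 sequences are sequences of residues because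
  \<open>p > 1\<close>.\<close>

lemma card_of_nat_sequences_mod:
  assumes "p > 1"
  shows "|(UNIV :: nat set) \<rightarrow>\<^sub>E {0..<int p}| =o continuum"
proof -
  let ?K = "(UNIV :: nat set) \<rightarrow>\<^sub>E {0..<int p}"
  let ?code = "\<lambda>f m. f (fst (prod_decode m)) = int (snd (prod_decode m))"
  have "inj_on ?code ?K"
  proof (rule inj_onI)
    fix f g assume f: "f \<in> ?K" and eq: "?code f = ?code g"
    show "f = g"
    proof
      fix n
      \<comment> \<open>The code of \<open>f\<close> is true at the pair of \<open>n\<close> and
        \<open>f n\<close>, so that of \<open>g\<close> is true there as well, which forces
        \<open>g n = f n\<close>.\<close>
      have "?code f (prod_encode (n, nat (f n))) = ?code g (prod_encode (n, nat (f n)))"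
        using eq by metis
      then show "f n = g n" using f by (simp add: PiE_iff)
    qed
  qed
  then have le: "|?K| \<le>o continuum"
    unfolding continuum_eq using card_of_ordLeq by blast
  let ?bit = "\<lambda>b n. if b n then 1 else 0 :: int"
  have "inj_on ?bit (UNIV :: (nat \<Rightarrow> bool) set)"
    by (rule inj_onI) (metis (full_types) ext zero_neq_one)
  moreover have "range ?bit \<subseteq> ?K" using assms by auto
  ultimately have "continuum \<le>o |?K|"
    unfolding continuum_eq using card_of_ordLeq by blast
  with le show ?thesis by (simp add: ordIso_iff_ordLeq)
qed

text \<open>Each slice over a point of \<open>D\<close> is compact, so its projection to the
  discrete space \<open>D'\<close> is finite. These finite sets, indexed by \<open>D\<close>, cover
  \<open>D'\<close> since \<open>C'\<close> is nonempty, and \<open>D'\<close> is infinite.\<close>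

lemma compact_times_discrete_homeomorphic_imp_card_le:
  assumes homeo: "prod_topology C (discrete_topology D) homeomorphic_space prod_topology C' (discrete_topology D')"
    and C: "compact_space C" and C': "topspace C' \<noteq> {}" and D': "infinite D'"
  shows "|D'| \<le>o |D|"
proof -
  obtain h where h: "homeomorphic_map (prod_topology C (discrete_topology D)) (prod_topology C' (discrete_topology D')) h"
    using homeo homeomorphic_space by blast
  define F where "F = (\<lambda>d. snd ` h ` (topspace C \<times> {d}))"
  have cont: "continuous_map (prod_topology C (discrete_topology D)) (discrete_topology D') (snd \<circ> h)"
    using continuous_map_compose[OF homeomorphic_imp_continuous_map[OF h] continuous_map_snd] .
  have fin: "finite (F d)" if "d \<in> D" for d
  proof -
    have "compactin (prod_topology C (discrete_topology D)) (topspace C \<times> {d})"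
      using C that by (simp add: compactin_Times compact_space_def compactin_discrete_topology)
    from image_compactin[OF this cont] show ?thesis
      by (simp add: F_def image_comp compactin_discrete_topology)
  qed
  have "h ` (topspace C \<times> D) = topspace C' \<times> D'"
    using homeomorphic_imp_surjective_map[OF h] by simp
  moreover have "(\<Union>d\<in>D. F d) = snd ` h ` (topspace C \<times> D)"
    by (auto simp: F_def)
  ultimately have un: "(\<Union>d\<in>D. F d) = D'"
    using C' by simp
  have "infinite D"
    using un fin D' by auto
  then have "|\<Union>d\<in>D. F d| \<le>o |D|"
    using fin by (intro card_of_UNION_ordLeq_infinite) (auto intro: ordLess_imp_ordLeq)
  then show ?thesis by (simp add: un)
qed

text \<open>A slice over \<open>d\<close> is an infinite compact set, whereas compact subsets of a
  discrete space are finite.\<close>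

lemma compact_times_discrete_not_homeomorphic_discrete:
  assumes C: "compact_space C" "infinite (topspace C)" and d: "d \<in> D"
  shows "\<not> prod_topology C (discrete_topology D) homeomorphic_space discrete_topology A"
proof
  assume "prod_topology C (discrete_topology D) homeomorphic_space discrete_topology A"
  then obtain h where h: "homeomorphic_map (prod_topology C (discrete_topology D)) (discrete_topology A) h"
    using homeomorphic_space by blast
  have "compactin (prod_topology C (discrete_topology D)) (topspace C \<times> {d})"
    using C d by (simp add: compactin_Times compact_space_def compactin_discrete_topology)
  from image_compactin[OF this homeomorphic_imp_continuous_map[OF h]]
  have "finite (h ` (topspace C \<times> {d}))"
    by (simp add: compactin_discrete_topology)
  moreover have "inj_on h (topspace C \<times> {d})"
    using homeomorphic_imp_injective_map[OF h] d by (auto intro: inj_on_subset)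
  ultimately have "finite (topspace C \<times> {d})"
    by (rule finite_imageD)
  then show False
    using C by (auto simp: finite_cartesian_product_iff)
qed

text \<open>The product of \<open>?K\<close> and \<open>?D\<close> is elementary abelian of
  cardinality continuum, hence isomorphic to the sum over \<open>J\<close>; its product topology is
  pulled back along an isomorphism.\<close>

lemma ex_lc_topology_compact_times_discrete:
  fixes J :: "'j set" and L :: "'l set"
  assumes p: "prime p" and J: "|J| =o continuum" and L: "|carrier (sum_Zp p L)| \<le>o continuum"
  shows "\<exists>T. lc_hausdorff_group_topology (sum_Zp p J) T \<and>
    T homeomorphic_space
      prod_topology (product_topology (\<lambda>_::nat. discrete_topology {0..<int p}) UNIV)
        (discrete_topology (carrier (sum_Zp p L)))"
proof -
  let ?K = "product_group (UNIV :: nat set) (\<lambda>_. integer_mod_group p)"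
  let ?D = "sum_Zp p L"
  let ?X = "prod_topology (product_topology (\<lambda>_::nat. discrete_topology {0..<int p}) UNIV)
        (discrete_topology (carrier ?D))"
  have p1: "p > 1" using p by (rule prime_gt_1_nat)
  have carr: "carrier (integer_mod_group p) = {0..<int p}"
    using p1 by (simp add: carrier_integer_mod_group)
  have K: "|carrier ?K| =o continuum"
    using card_of_nat_sequences_mod[OF p1] by (simp add: carr)
  have "infinite (UNIV :: (nat \<Rightarrow> bool) set)"
    by (simp add: finite_UNIV_fun)
  then have infc: "infinite (carrier ?K)"
    using card_of_ordIso_finite[OF K[unfolded continuum_eq]] by simp
  have "|carrier ?D| \<le>o |carrier ?K|"
    using L K ordIso_symmetric ordLeq_ordIso_trans by blast
  \<comment> \<open>An infinite cardinal absorbs a nonempty factor that is no larger.\<close>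
  then have "|carrier ?K \<times> carrier ?D| =o |carrier ?K|"
    using card_of_Times_infinite[OF infc, of "carrier ?D"] group.is_monoid[OF sum_group]
    by (metis group_integer_mod_group monoid.carrier_not_empty sum_group group.is_monoid)
  then have "|carrier (?K \<times>\<times> ?D)| =o |J|"
    by (metis K J carrier_DirProd ordIso_symmetric ordIso_transitive)
  moreover have "infinite J"
    using infc K J by (meson card_of_ordIso_finite ordIso_symmetric ordIso_transitive)
  moreover have "elementary_abelian p (?K \<times>\<times> ?D)"
    by (intro elementary_abelian_DirProd elementary_abelian_product_group
        elementary_abelian_integer_mod_group elementary_abelian_sum_Zp)
  ultimately obtain \<phi> where \<phi>: "\<phi> \<in> iso (sum_Zp p J) (?K \<times>\<times> ?D)"
    using is_iso_sum_Zp[OF p] unfolding is_iso_def by blast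
  have "lc_hausdorff_group_topology (integer_mod_group p) (discrete_topology {0..<int p})"
    using lc_hausdorff_group_topology_discrete[of "integer_mod_group p"] by (simp add: carr)
  then have "lc_hausdorff_group_topology (?K \<times>\<times> ?D) ?X"
    by (intro lc_hausdorff_group_topology_DirProd lc_hausdorff_group_topology_product_group
        lc_hausdorff_group_topology_discrete)
      (auto simp: compact_space_discrete_topology)
  then show ?thesis
    using lc_hausdorff_group_topology_pullback[OF _ _ \<phi>] by fastforce
qed

section \<open>Uniqueness over the first uncountable cardinal, and five topologies over the
  continuum\<close>

theorem proposition2p3:
  fixes p :: nat and I :: "'i set" and J :: "'j set"
  assumes "prime p"
    and "aleph_one <o continuum"
    and "|I| =o aleph_one"
    and "|J| =o continuum"
  shows "{T. lc_hausdorff_group_topology (sum_Zp p I) T} =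
           {discrete_topology (carrier (sum_Zp p I))} \<and>
         (\<exists>S. card S = 5 \<and>
              (\<forall>T\<in>S. lc_hausdorff_group_topology (sum_Zp p J) T) \<and>
              pairwise (\<lambda>T T'. \<not> T homeomorphic_space T') S)"
proof
  have nat_I: "|UNIV :: nat set| <o |I|"
    using cardSuc_greater[OF natLeq_Card_order] card_of_nat assms(3)
    by (meson ordIso_ordLess_trans ordIso_symmetric ordLess_ordIso_trans)
  have I_J: "|I| <o |J|"
    using assms(2,3,4) by (meson ordIso_ordLess_trans ordIso_symmetric ordLess_ordIso_trans)
  have infI: "infinite I"
    using nat_I infinite_iff_card_of_nat ordLess_imp_ordLeq by blast
  have "|carrier (sum_Zp p I)| <o continuum"
    using card_of_sum_Zp[OF infI assms(1)] assms(2,3) by (meson ordIso_ordLess_trans)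
  then show "{T. lc_hausdorff_group_topology (sum_Zp p I) T} = {discrete_topology (carrier (sum_Zp p I))}"
    using lc_hausdorff_group_topology_small_imp_discrete lc_hausdorff_group_topology_discrete[of "sum_Zp p I"]
    by auto
  \<comment> \<open>The ranges of \<open>f\<close> and \<open>g\<close> are subsets of
    \<open>J\<close> of cardinality aleph_0 and aleph_1. With all index sets inside
    \<open>J\<close>, the spaces \<open>?X L\<close> have one common type.\<close>
  obtain f :: "nat \<Rightarrow> 'j" where f: "inj f" "range f \<subseteq> J"
    using ordLess_imp_ordLeq[OF ordLess_transitive[OF nat_I I_J]] unfolding card_of_ordLeq[symmetric] by blast
  obtain g :: "'i \<Rightarrow> 'j" where g: "inj_on g I" "g ` I \<subseteq> J"
    using ordLess_imp_ordLeq[OF I_J] unfolding card_of_ordLeq[symmetric] by blast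
  let ?D = "\<lambda>L::'j set. carrier (sum_Zp p L)"
  let ?C = "product_topology (\<lambda>_::nat. discrete_topology {0..<int p}) UNIV"
  let ?X = "\<lambda>L. prod_topology ?C (discrete_topology (?D L))"
  have p1: "p > 1" using assms(1) by (rule prime_gt_1_nat)
  have inf: "infinite (range f)" "infinite (g ` I)" "infinite J"
    using f g infI range_inj_infinite finite_imageD infinite_super by blast+
  have f_nat: "|range f| =o |UNIV :: nat set|" and g_I: "|g ` I| =o |I|"
    using f(1) g(1) card_of_ordIso inj_on_imp_bij_betw ordIso_symmetric by blast+
  have D: "|?D L| =o |L|" if "infinite L" for L :: "'j set"
    using card_of_sum_Zp[OF that assms(1)] .
  have infD: "infinite (?D L)" if "infinite L" for L :: "'j set"
    using card_of_ordIso_finite[OF D[OF that]] that by simp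
  \<comment> \<open>The empty sum is trivial, so \<open>?X {}\<close> is essentially the compact
    factor alone.\<close>
  have D_empty: "finite (?D {})"
    by (simp add: carrier_sum_group)
  have D_less: "|?D L| <o |?D L'|" if "infinite L" "infinite L'" "|L| <o |L'|" for L L' :: "'j set"
    using D that by (meson ordIso_ordLess_trans ordIso_symmetric ordLess_ordIso_trans)
  have D_less_empty: "|?D {}| <o |?D L|" if "infinite L" for L
    using finite_ordLess_infinite2[OF D_empty infD[OF that]] .
  have less: "|range f| <o |g ` I|"
    using f_nat g_I nat_I by (meson ordIso_ordLess_trans ordIso_symmetric ordLess_ordIso_trans)
  have less_J: "|g ` I| <o |J|"
    using g_I I_J by (rule ordIso_ordLess_trans)
  \<comment> \<open>One strict inequality for each of the six pairs among the four discrete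
    factors.\<close>
  note lt = D_less_empty[OF inf(1)] D_less_empty[OF inf(2)] D_less_empty[OF inf(3)]
    D_less[OF inf(1,2) less] D_less[OF inf(1,3) ordLess_transitive[OF less less_J]] D_less[OF inf(2,3) less_J]
  have "\<exists>T. lc_hausdorff_group_topology (sum_Zp p J) T \<and> T homeomorphic_space ?X L" if "L \<subseteq> J" for L
  proof (rule ex_lc_topology_compact_times_discrete[OF assms(1,4)])
    have "|?D L| \<le>o |?D J|"
    proof (cases "finite L")
      case True
      then have "finite (?D L)"
        using finite_carrier_sum_Zp[OF _ True, of p] p1 by simp
      then show ?thesis using infD[OF inf(3)] by (simp add: ordLess_imp_ordLeq)
    next
      case False
      then show ?thesis
        using D inf(3) card_of_mono1[OF that] by (meson ordIso_ordLeq_trans ordIso_symmetric ordLeq_ordIso_trans)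
    qed
    then show "|?D L| \<le>o continuum"
      using D[OF inf(3)] assms(4) by (meson ordLeq_ordIso_trans)
  qed
  then obtain T where T: "\<And>L. L \<subseteq> J \<Longrightarrow> lc_hausdorff_group_topology (sum_Zp p J) (T L)"
    and TX: "\<And>L. L \<subseteq> J \<Longrightarrow> T L homeomorphic_space ?X L"
    by metis
  have C: "compact_space ?C" by (simp add: compact_space_product_topology compact_space_discrete_topology)
  have "infinite (UNIV :: (nat \<Rightarrow> bool) set)"
    by (simp add: finite_UNIV_fun)
  then have infC: "infinite (topspace ?C)"
    using card_of_ordIso_finite[OF card_of_nat_sequences_mod[OF p1, unfolded continuum_eq]] by simp
  \<comment> \<open>The invariant is applied with the larger, infinite factor as target. The smaller
    factor may be finite, which covers \<open>L = {}\<close>.\<close>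
  have nh: "\<not> T L homeomorphic_space T L'" "\<not> T L' homeomorphic_space T L"
    if "L \<subseteq> J" "L' \<subseteq> J" "infinite L'" "|?D L| <o |?D L'|" for L L'
  proof -
    show *: "\<not> T L homeomorphic_space T L'"
    proof
      assume "T L homeomorphic_space T L'"
      then have "?X L homeomorphic_space ?X L'"
        using TX that by (meson homeomorphic_space_sym homeomorphic_space_trans)
      then have "|?D L'| \<le>o |?D L|"
        using compact_times_discrete_homeomorphic_imp_card_le[OF _ C] infC infD[OF that(3)] by fastforce
      then show False using that(4) not_ordLess_ordLeq by blast
    qed
    then show "\<not> T L' homeomorphic_space T L"
      using homeomorphic_space_sym by blast
  qed
  \<comment> \<open>The fifth topology. It differs from every \<open>T L\<close> because
    \<open>?X L\<close> contains an infinite compact slice, over the neutral element of the discrete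
    factor.\<close>
  let ?T = "discrete_topology (?D J)"
  have nd: "\<not> T L homeomorphic_space ?T" "\<not> ?T homeomorphic_space T L" if "L \<subseteq> J" for L
  proof -
    have "\<one>\<^bsub>sum_Zp p L\<^esub> \<in> ?D L"
      by (meson group.is_monoid group_integer_mod_group monoid.one_closed sum_group)
    then have "\<not> ?X L homeomorphic_space ?T"
      by (rule compact_times_discrete_not_homeomorphic_discrete[OF C infC])
    then show "\<not> T L homeomorphic_space ?T" "\<not> ?T homeomorphic_space T L"
      using TX[OF that] by (meson homeomorphic_space_sym homeomorphic_space_trans)+
  qed
  note sub = empty_subsetI f(2) g(2) subset_refl
  note ne = nh[OF sub(1,2) inf(1) lt(1)] nh[OF sub(1,3) inf(2) lt(2)] nh[OF sub(1,4) inf(3) lt(3)]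
    nh[OF sub(2,3) inf(2) lt(4)] nh[OF sub(2,4) inf(3) lt(5)] nh[OF sub(3,4) inf(3) lt(6)]
    nd[OF sub(1)] nd[OF sub(2)] nd[OF sub(3)] nd[OF sub(4)]
  let ?S = "{?T, T {}, T (range f), T (g ` I), T J}"
  \<comment> \<open>Homeomorphism is reflexive, so topologies that are pairwise nonhomeomorphic are
    distinct.\<close>
  have "distinct [?T, T {}, T (range f), T (g ` I), T J]"
    using ne homeomorphic_space_refl by (metis (no_types, lifting) distinct_length_2_or_more distinct_singleton)
  then have "card ?S = 5"
    using distinct_card[of "[?T, T {}, T (range f), T (g ` I), T J]"] by simp
  moreover have "\<forall>T\<in>?S. lc_hausdorff_group_topology (sum_Zp p J) T"
    using T f g lc_hausdorff_group_topology_discrete[of "sum_Zp p J"] by auto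
  moreover have "pairwise (\<lambda>T T'. \<not> T homeomorphic_space T') ?S"
    unfolding pairwise_def using ne by blast
  ultimately show "\<exists>S. card S = 5 \<and> (\<forall>T\<in>S. lc_hausdorff_group_topology (sum_Zp p J) T) \<and>
      pairwise (\<lambda>T T'. \<not> T homeomorphic_space T') S"
    by blast
qed

end
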